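(* Every $K$-semigroup $S$ is a splitting ideal extension of a 3-nilpotent ideal $A$ by the subsemigroup $T=(S\setminus A)\cup\{0\}$. The quotient semigroup of $T$ by its greatest 0-restricted congruence is isomorphic to a subsemigroup of a Rees semigroup with the one-element basic group, i.e. of a Rees semigroup $M^0(1;I,\Lambda;W)$ for some sets $I,\Lambda$ and some matrix $W=(w_{\lambda i})_{\lambda\in\Lambda,\,i\in I}$ with entries in $\{0,1\}$.
   Context: A $K$-semigroup (semigroup categorical at zero) is a semigroup $S$ with zero $0$ such that for all $f,g,h\in S$: if $fgh=0$ then $fg=0$ or $gh=0$. A semigroup $A$ with zero is 3-nilpotent if $A^3=\{0\}$, i.e. $abc=0$ for all $a,b,c\in A$. "Ideal" means two-sided ideal. $S$ is called a splitting ideal extension of an ideal $A$ by $T=(S\setminus A)\cup\{0\}$ if the subset $T$ is a subsemigroup of $S$. A homomorphism of semigroups with zero is 0-restricted if the complete preimage of zero consists of one element; a congruence is 0-restricted if it corresponds to a 0-restricted homomorphism, i.e. if the congruence class of $0$ is $\{0\}$. "Greatest" is with respect to inclusion of relations. The Rees semigroup $M^0(1;I,\Lambda;W)$ with one-element basic group, where $W=(w_{\lambda i})$ is a $\Lambda\times I$ matrix with entries in $\{0,1\}$ (no further condition on $W$), is the set $(I\times\Lambda)\cup\{0\}$ in which $0$ is a zero element and $(i,\lambda)(j,\mu)=(i,\mu)$ if $w_{\lambda j}=1$, and $(i,\lambda)(j,\mu)=0$ if $w_{\lambda j}=0$. *)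

theory Defs
  imports "HOL-Algebra.Congruence"
begin

section \<open>Semigroups with zero\<close>

record 'a semigroup0 = "'a partial_object" +
  mult :: "'a \<Rightarrow> 'a \<Rightarrow> 'a"  (infixl \<open>\<cdot>\<index>\<close> 70)
  zero :: 'a  (\<open>\<zero>\<index>\<close>)

locale semigroup_with_zero =
  fixes S (structure)
  assumes mult_closed: "\<lbrakk>a \<in> carrier S; b \<in> carrier S\<rbrakk> \<Longrightarrow> a \<cdot> b \<in> carrier S"
    and mult_assoc: "\<lbrakk>a \<in> carrier S; b \<in> carrier S; c \<in> carrier S\<rbrakk> \<Longrightarrow> a \<cdot> b \<cdot> c = a \<cdot> (b \<cdot> c)"
    and zero_closed: "\<zero> \<in> carrier S"
    and zero_mult: "a \<in> carrier S \<Longrightarrow> \<zero> \<cdot> a = \<zero>"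
    and mult_zero: "a \<in> carrier S \<Longrightarrow> a \<cdot> \<zero> = \<zero>"

locale K_semigroup = semigroup_with_zero +
  assumes categorical_at_zero:
    "\<lbrakk>f \<in> carrier S; g \<in> carrier S; h \<in> carrier S; f \<cdot> g \<cdot> h = \<zero>\<rbrakk> \<Longrightarrow> f \<cdot> g = \<zero> \<or> g \<cdot> h = \<zero>"

definition restrict_to :: "'a semigroup0 \<Rightarrow> 'a set \<Rightarrow> 'a semigroup0"
  where "restrict_to S X = S\<lparr>carrier := X\<rparr>"

text \<open>Substructures are taken in the category of semigroups with zero, so they contain the zero.\<close>

definition subsemigroup :: "'a set \<Rightarrow> 'a semigroup0 \<Rightarrow> bool"
  where "subsemigroup X S \<longleftrightarrow>
    X \<subseteq> carrier S \<and> \<zero>\<^bsub>S\<^esub> \<in> X \<and> (\<forall>a\<in>X. \<forall>b\<in>X. a \<cdot>\<^bsub>S\<^esub> b \<in> X)"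

definition ideal :: "'a set \<Rightarrow> 'a semigroup0 \<Rightarrow> bool"
  where "ideal A S \<longleftrightarrow> A \<subseteq> carrier S \<and> A \<noteq> {} \<and>
    (\<forall>a\<in>A. \<forall>s\<in>carrier S. s \<cdot>\<^bsub>S\<^esub> a \<in> A \<and> a \<cdot>\<^bsub>S\<^esub> s \<in> A)"

definition three_nilpotent :: "'a semigroup0 \<Rightarrow> bool"
  where "three_nilpotent A \<longleftrightarrow>
    (\<forall>a\<in>carrier A. \<forall>b\<in>carrier A. \<forall>c\<in>carrier A. a \<cdot>\<^bsub>A\<^esub> b \<cdot>\<^bsub>A\<^esub> c = \<zero>\<^bsub>A\<^esub>)"

definition splitting_ideal_extension :: "'a semigroup0 \<Rightarrow> 'a set \<Rightarrow> 'a set \<Rightarrow> bool"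
  where "splitting_ideal_extension S A T \<longleftrightarrow>
    ideal A S \<and> T = (carrier S - A) \<union> {\<zero>\<^bsub>S\<^esub>} \<and> subsemigroup T S"

definition isomorphic :: "'a semigroup0 \<Rightarrow> 'b semigroup0 \<Rightarrow> bool"
  where "isomorphic S S' \<longleftrightarrow>
    (\<exists>h. bij_betw h (carrier S) (carrier S') \<and>
         h \<zero>\<^bsub>S\<^esub> = \<zero>\<^bsub>S'\<^esub> \<and>
         (\<forall>a\<in>carrier S. \<forall>b\<in>carrier S. h (a \<cdot>\<^bsub>S\<^esub> b) = h a \<cdot>\<^bsub>S'\<^esub> h b))"

section \<open>Congruences and quotients\<close>

definition congruence_on :: "'a semigroup0 \<Rightarrow> 'a rel \<Rightarrow> bool"
  where "congruence_on S \<rho> \<longleftrightarrow> equiv (carrier S) \<rho> \<and>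
    (\<forall>(a, a')\<in>\<rho>. \<forall>(b, b')\<in>\<rho>. (a \<cdot>\<^bsub>S\<^esub> b, a' \<cdot>\<^bsub>S\<^esub> b') \<in> \<rho>)"

definition zero_restricted_congruence :: "'a semigroup0 \<Rightarrow> 'a rel \<Rightarrow> bool"
  where "zero_restricted_congruence S \<rho> \<longleftrightarrow>
    congruence_on S \<rho> \<and> \<rho> `` {\<zero>\<^bsub>S\<^esub>} = {\<zero>\<^bsub>S\<^esub>}"

definition greatest_zero_restricted_congruence :: "'a semigroup0 \<Rightarrow> 'a rel \<Rightarrow> bool"
  where "greatest_zero_restricted_congruence S \<rho> \<longleftrightarrow>
    zero_restricted_congruence S \<rho> \<and>
    (\<forall>\<sigma>. zero_restricted_congruence S \<sigma> \<longrightarrow> \<sigma> \<subseteq> \<rho>)"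

text \<open>For a congruence all sets in the union below coincide.\<close>

definition quotient_semigroup :: "'a semigroup0 \<Rightarrow> 'a rel \<Rightarrow> 'a set semigroup0"
  where "quotient_semigroup S \<rho> =
    \<lparr>carrier = carrier S // \<rho>,
     mult = (\<lambda>X Y. \<Union>x\<in>X. \<Union>y\<in>Y. \<rho> `` {x \<cdot>\<^bsub>S\<^esub> y}),
     zero = \<rho> `` {\<zero>\<^bsub>S\<^esub>}\<rparr>"

lemma quotient_mult:
  assumes "semigroup_with_zero S" "congruence_on S \<rho>" "a \<in> carrier S" "b \<in> carrier S"
  shows "(\<rho> `` {a}) \<cdot>\<^bsub>quotient_semigroup S \<rho>\<^esub> (\<rho> `` {b}) = \<rho> `` {a \<cdot>\<^bsub>S\<^esub> b}"
proof -
  interpret semigroup_with_zero S by fact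
  have eq: "equiv (carrier S) \<rho>" using assms(2) by (simp add: congruence_on_def)
  have cls: "\<rho> `` {x \<cdot>\<^bsub>S\<^esub> y} = \<rho> `` {a \<cdot>\<^bsub>S\<^esub> b}"
    if "x \<in> \<rho> `` {a}" "y \<in> \<rho> `` {b}" for x y
  proof -
    have "(a \<cdot>\<^bsub>S\<^esub> b, x \<cdot>\<^bsub>S\<^esub> y) \<in> \<rho>"
      using that assms(2) unfolding congruence_on_def by blast
    then show ?thesis using equiv_class_eq[OF eq] by blast
  qed
  have "a \<in> \<rho> `` {a}" "b \<in> \<rho> `` {b}"
    using equiv_class_self[OF eq] assms(3,4) by blast+
  then have "(\<Union>x\<in>\<rho> `` {a}. \<Union>y\<in>\<rho> `` {b}. \<rho> `` {x \<cdot>\<^bsub>S\<^esub> y}) = \<rho> `` {a \<cdot>\<^bsub>S\<^esub> b}"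
    using cls by blast
  then show ?thesis by (simp add: quotient_semigroup_def)
qed

section \<open>Rees semigroups over the one-element group\<close>

text \<open>The pair \<open>(i, \<lambda>)\<close> is represented by \<open>Some (i, \<lambda>)\<close> and the zero by \<open>None\<close>.\<close>

definition Rees :: "'i set \<Rightarrow> 'l set \<Rightarrow> ('l \<Rightarrow> 'i \<Rightarrow> nat) \<Rightarrow> ('i \<times> 'l) option semigroup0"
  where "Rees I \<Lambda> W =
    \<lparr>carrier = Some ` (I \<times> \<Lambda>) \<union> {None},
     mult = (\<lambda>x y. case (x, y) of
        (Some (i, l), Some (j, m)) \<Rightarrow> (if W l j = 1 then Some (i, m) else None)
      | _ \<Rightarrow> None),
     zero = None\<rparr>"

lemma Rees_semigroup: "semigroup_with_zero (Rees I \<Lambda> W)"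
  by unfold_locales (auto simp: Rees_def split: option.splits)

end

theory Submission
  imports Defs
begin

text \<open>
  Let \<open>A\<close> consist of the elements \<open>a\<close> with \<open>s \<cdot> a \<cdot> t = \<zero>\<close> for all \<open>s, t\<close>. Then \<open>A\<close> is a 3-nilpotent
  ideal, and by categoricity at zero its complement together with \<open>\<zero>\<close> is closed: if \<open>s \<cdot> a\<close>, \<open>a \<cdot> b\<close>
  and \<open>b \<cdot> t\<close> are nonzero, so is \<open>s \<cdot> a \<cdot> b \<cdot> t\<close>.

  In any K-semigroup, if \<open>a \<cdot> b \<noteq> \<zero>\<close> then \<open>a \<cdot> b\<close> has the left annihilator of \<open>a\<close> and the right
  annihilator of \<open>b\<close>. Hence sending a nonzero \<open>a\<close> to the pair of its left and right annihilators is
  a homomorphism into a Rees semigroup. Only \<open>\<zero>\<close> goes to zero, and every 0-restricted congruence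
  preserves annihilators, so the kernel is the greatest 0-restricted congruence.
\<close>

section \<open>Homomorphisms of semigroups with zero, their kernels and images\<close>

definition zero_hom :: "'a semigroup0 \<Rightarrow> 'b semigroup0 \<Rightarrow> ('a \<Rightarrow> 'b) \<Rightarrow> bool"
  where "zero_hom S R h \<longleftrightarrow> h ` carrier S \<subseteq> carrier R \<and> h \<zero>\<^bsub>S\<^esub> = \<zero>\<^bsub>R\<^esub> \<and>
    (\<forall>a\<in>carrier S. \<forall>b\<in>carrier S. h (a \<cdot>\<^bsub>S\<^esub> b) = h a \<cdot>\<^bsub>R\<^esub> h b)"

definition kernel_on :: "'a semigroup0 \<Rightarrow> ('a \<Rightarrow> 'b) \<Rightarrow> 'a rel"
  where "kernel_on S h = {(a, b). a \<in> carrier S \<and> b \<in> carrier S \<and> h a = h b}"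

lemma restrict_to_simps [simp]:
  "carrier (restrict_to S X) = X"
  "mult (restrict_to S X) = mult S"
  "zero (restrict_to S X) = zero S"
  by (simp_all add: restrict_to_def)

lemma Rees_simps [simp]:
  "carrier (Rees I \<Lambda> W) = Some ` (I \<times> \<Lambda>) \<union> {None}"
  "zero (Rees I \<Lambda> W) = None"
  "None \<cdot>\<^bsub>Rees I \<Lambda> W\<^esub> x = None"
  "x \<cdot>\<^bsub>Rees I \<Lambda> W\<^esub> None = None"
  "Some (i, l) \<cdot>\<^bsub>Rees I \<Lambda> W\<^esub> Some (j, m) = (if W l j = 1 then Some (i, m) else None)"
  by (simp_all add: Rees_def split: option.splits)

text \<open>Fixes the record type, since quotients are defined only for records without extra fields.\<close>

locale plain_semigroup_with_zero = semigroup_with_zero S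
  for S :: "'a semigroup0" (structure)
begin

lemma congruence_on_kernel:
  assumes "zero_hom S R h"
  shows "congruence_on S (kernel_on S h)"
proof -
  have "equiv (carrier S) (kernel_on S h)"
    by (rule equivI) (auto simp: kernel_on_def refl_on_def sym_def trans_def)
  then show ?thesis
    using assms mult_closed by (auto simp: congruence_on_def zero_hom_def kernel_on_def)
qed

lemma subsemigroup_image:
  assumes "zero_hom S R h"
  shows "subsemigroup (h ` carrier S) R"
proof -
  have "\<zero>\<^bsub>R\<^esub> = h \<zero>" "h a \<cdot>\<^bsub>R\<^esub> h b = h (a \<cdot> b)"
    if "a \<in> carrier S" "b \<in> carrier S" for a b
    using that assms by (simp_all add: zero_hom_def)
  then show ?thesis
    using assms zero_closed mult_closed by (auto simp: subsemigroup_def zero_hom_def)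
qed

lemma quotient_kernel_isomorphic_image:
  assumes h: "zero_hom S R h"
  shows "isomorphic (quotient_semigroup S (kernel_on S h)) (restrict_to R (h ` carrier S))"
proof -
  let ?\<rho> = "kernel_on S h"
  \<comment> \<open>All elements of a kernel class have the same value under \<open>h\<close>;
    \<open>the_elem\<close> extracts it without choosing a representative.\<close>
  define g where "g X = the_elem (h ` X)" for X
  have cong: "congruence_on S ?\<rho>" using congruence_on_kernel[OF h] .
  have "h ` (?\<rho> `` {a}) = {h a}" if "a \<in> carrier S" for a
    using that by (auto simp: kernel_on_def)
  then have g: "g (?\<rho> `` {a}) = h a" if "a \<in> carrier S" for a
    using that by (simp add: g_def)
  have carr: "carrier (quotient_semigroup S ?\<rho>) = (\<lambda>a. ?\<rho> `` {a}) ` carrier S"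
    by (auto simp: quotient_semigroup_def quotient_def)
  have "inj_on g (carrier (quotient_semigroup S ?\<rho>))"
    unfolding carr by (auto simp: inj_on_def g) (auto simp: kernel_on_def)
  moreover have "g ` carrier (quotient_semigroup S ?\<rho>) = h ` carrier S"
    unfolding carr using g by (simp add: image_image)
  moreover have "g \<zero>\<^bsub>quotient_semigroup S ?\<rho>\<^esub> = \<zero>\<^bsub>R\<^esub>"
    using g zero_closed h by (simp add: quotient_semigroup_def zero_hom_def)
  moreover have "g (X \<cdot>\<^bsub>quotient_semigroup S ?\<rho>\<^esub> Y) = g X \<cdot>\<^bsub>R\<^esub> g Y"
    if "X \<in> carrier (quotient_semigroup S ?\<rho>)" "Y \<in> carrier (quotient_semigroup S ?\<rho>)" for X Y
  proof -
    obtain a b where "a \<in> carrier S" "X = ?\<rho> `` {a}" "b \<in> carrier S" "Y = ?\<rho> `` {b}"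
      using \<open>X \<in> _\<close> \<open>Y \<in> _\<close> unfolding carr by blast
    then show ?thesis
      using g mult_closed h quotient_mult[OF semigroup_with_zero_axioms cong]
      by (simp add: zero_hom_def)
  qed
  ultimately show ?thesis
    unfolding isomorphic_def bij_betw_def by (intro exI[of _ g]) simp
qed

section \<open>Annihilators and their invariance under 0-restricted congruences\<close>

definition left_ann :: "'a \<Rightarrow> 'a set"
  where "left_ann a = {x \<in> carrier S. x \<cdot> a = \<zero>}"

definition right_ann :: "'a \<Rightarrow> 'a set"
  where "right_ann a = {x \<in> carrier S. a \<cdot> x = \<zero>}"

text \<open>The case split keeps nonzero elements away from \<open>None\<close> even when both their
  annihilators are the whole carrier.\<close>

definition ann_pair :: "'a \<Rightarrow> ('a set \<times> 'a set) option"
  where "ann_pair a = (if a = \<zero> then None else Some (left_ann a, right_ann a))"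

text \<open>Both indices are sets, so a representative \<open>b\<close> is recovered from
  \<open>i\<close>. If \<open>l\<close> is the right annihilator of \<open>a\<close>, then
  \<open>b \<notin> l\<close> means \<open>a \<cdot> b \<noteq> \<zero>\<close>.\<close>

definition sandwich :: "'a set \<Rightarrow> 'a set \<Rightarrow> nat"
  where "sandwich l i = (if \<exists>b\<in>carrier S. left_ann b = i \<and> b \<notin> l then 1 else 0)"

abbreviation ann_Rees :: "('a set \<times> 'a set) option semigroup0"
  where "ann_Rees \<equiv> Rees (left_ann ` carrier S) (right_ann ` carrier S) sandwich"

text \<open>The choice of representative does not matter: \<open>c \<in> right_ann a\<close> is the
  same as \<open>a \<in> left_ann c\<close>, which depends only on the left annihilator of
  \<open>c\<close>.\<close>

lemma sandwich_eq_1_iff: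
  assumes "a \<in> carrier S" "b \<in> carrier S"
  shows "sandwich (right_ann a) (left_ann b) = 1 \<longleftrightarrow> a \<cdot> b \<noteq> \<zero>"
proof -
  have "(\<exists>c\<in>carrier S. left_ann c = left_ann b \<and> c \<notin> right_ann a) \<longleftrightarrow> a \<cdot> b \<noteq> \<zero>"
    using assms unfolding left_ann_def right_ann_def by blast
  then show ?thesis
    by (simp add: sandwich_def)
qed

lemma zero_restricted_congruence_zero_iff:
  assumes "zero_restricted_congruence S \<sigma>" "(a, b) \<in> \<sigma>"
  shows "a = \<zero> \<longleftrightarrow> b = \<zero>"
proof -
  have "(b, a) \<in> \<sigma>" "\<sigma> `` {\<zero>} = {\<zero>}"
    using assms
    by (auto simp: zero_restricted_congruence_def congruence_on_def equiv_def elim: symE)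
  then show ?thesis using assms(2) by blast
qed

text \<open>Multiplying a related pair by \<open>x\<close> on either side gives related products,
  and these vanish together because the class of zero is trivial.\<close>

lemma zero_restricted_congruence_ann_pair:
  assumes \<sigma>: "zero_restricted_congruence S \<sigma>" and ab: "(a, b) \<in> \<sigma>"
  shows "ann_pair a = ann_pair b"
proof -
  have cong: "congruence_on S \<sigma>"
    using \<sigma> by (simp add: zero_restricted_congruence_def)
  have "(x \<cdot> a, x \<cdot> b) \<in> \<sigma> \<and> (a \<cdot> x, b \<cdot> x) \<in> \<sigma>" if "x \<in> carrier S" for x
  proof -
    have "(x, x) \<in> \<sigma>"
      using that cong by (auto simp: congruence_on_def equiv_def refl_on_def)
    then show ?thesis using ab cong unfolding congruence_on_def by blast
  qed
  then have "left_ann a = left_ann b" "right_ann a = right_ann b"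
    using zero_restricted_congruence_zero_iff[OF \<sigma>] unfolding left_ann_def right_ann_def by blast+
  then show ?thesis
    using zero_restricted_congruence_zero_iff[OF \<sigma> ab] by (simp add: ann_pair_def)
qed

end

section \<open>Embedding the quotient of a K-semigroup into a Rees semigroup\<close>

locale plain_K_semigroup = plain_semigroup_with_zero S + K_semigroup S
  for S :: "'a semigroup0" (structure)
begin

lemma mult_mult_eq_zero_iff:
  assumes "a \<in> carrier S" "b \<in> carrier S" "c \<in> carrier S"
  shows "a \<cdot> b \<cdot> c = \<zero> \<longleftrightarrow> a \<cdot> b = \<zero> \<or> b \<cdot> c = \<zero>"
  using assms categorical_at_zero[of a b c] mult_assoc[of a b c] zero_mult mult_zero by auto

text \<open>By associativity and categoricity at zero, \<open>x \<cdot> (a \<cdot> b)\<close>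
  vanishes only through \<open>x \<cdot> a\<close> or \<open>a \<cdot> b\<close>, and the latter is
  nonzero.\<close>

lemma left_ann_mult:
  assumes "a \<in> carrier S" "b \<in> carrier S" "a \<cdot> b \<noteq> \<zero>"
  shows "left_ann (a \<cdot> b) = left_ann a"
proof -
  have "x \<cdot> (a \<cdot> b) = \<zero> \<longleftrightarrow> x \<cdot> a = \<zero>" if "x \<in> carrier S" for x
    using mult_mult_eq_zero_iff[OF that assms(1,2)] mult_assoc[OF that assms(1,2)] assms(3) by simp
  then show ?thesis by (auto simp: left_ann_def)
qed

lemma right_ann_mult:
  assumes "a \<in> carrier S" "b \<in> carrier S" "a \<cdot> b \<noteq> \<zero>"
  shows "right_ann (a \<cdot> b) = right_ann b"
proof -
  have "a \<cdot> b \<cdot> x = \<zero> \<longleftrightarrow> b \<cdot> x = \<zero>" if "x \<in> carrier S" for x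
    using mult_mult_eq_zero_iff[OF assms(1,2) that] assms(3) by simp
  then show ?thesis by (auto simp: right_ann_def)
qed

text \<open>A nonzero product keeps the left annihilator of its first factor and the right
  annihilator of its second, which are the coordinates of the Rees product; the sandwich entry
  detects whether the product is nonzero.\<close>

lemma zero_hom_ann_pair: "zero_hom S ann_Rees ann_pair"
proof -
  have "ann_pair (a \<cdot> b) = ann_pair a \<cdot>\<^bsub>ann_Rees\<^esub> ann_pair b"
    if "a \<in> carrier S" "b \<in> carrier S" for a b
    using that sandwich_eq_1_iff[OF that] left_ann_mult[OF that] right_ann_mult[OF that]
    by (auto simp: ann_pair_def zero_mult mult_zero)
  moreover have "ann_pair ` carrier S \<subseteq> carrier ann_Rees" "ann_pair \<zero> = \<zero>\<^bsub>ann_Rees\<^esub>"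
    by (auto simp: ann_pair_def)
  ultimately show ?thesis
    unfolding zero_hom_def by blast
qed

lemma greatest_zero_restricted_congruence_kernel:
  "greatest_zero_restricted_congruence S (kernel_on S ann_pair)"
proof -
  have "ann_pair \<zero> = ann_pair a \<longleftrightarrow> a = \<zero>" for a
    by (simp add: ann_pair_def)
  then have "kernel_on S ann_pair `` {\<zero>} = {\<zero>}"
    using zero_closed by (auto simp: kernel_on_def)
  then have "zero_restricted_congruence S (kernel_on S ann_pair)"
    using congruence_on_kernel[OF zero_hom_ann_pair]
    by (simp add: zero_restricted_congruence_def)
  moreover have "\<sigma> \<subseteq> kernel_on S ann_pair" if "zero_restricted_congruence S \<sigma>" for \<sigma>
  proof -
    have "\<sigma> \<subseteq> carrier S \<times> carrier S"
      using that by (simp add: zero_restricted_congruence_def congruence_on_def equiv_def)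
    then show ?thesis
      using zero_restricted_congruence_ann_pair[OF that] by (auto simp: kernel_on_def)
  qed
  ultimately show ?thesis by (simp add: greatest_zero_restricted_congruence_def)
qed

lemma quotient_embeds_in_Rees:
  "\<exists>\<rho>. greatest_zero_restricted_congruence S \<rho> \<and>
    (\<exists>(I :: 'a set set) (\<Lambda> :: 'a set set) W P.
       (\<forall>l\<in>\<Lambda>. \<forall>i\<in>I. W l i \<in> {0, 1}) \<and>
       subsemigroup P (Rees I \<Lambda> W) \<and>
       isomorphic (quotient_semigroup S \<rho>) (restrict_to (Rees I \<Lambda> W) P))"
proof (intro exI conjI)
  show "greatest_zero_restricted_congruence S (kernel_on S ann_pair)"
    by (fact greatest_zero_restricted_congruence_kernel)
  show "\<forall>l\<in>right_ann ` carrier S. \<forall>i\<in>left_ann ` carrier S. sandwich l i \<in> {0, 1}"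
    by (simp add: sandwich_def)
  show "subsemigroup (ann_pair ` carrier S) ann_Rees"
    by (fact subsemigroup_image[OF zero_hom_ann_pair])
  show "isomorphic (quotient_semigroup S (kernel_on S ann_pair))
      (restrict_to ann_Rees (ann_pair ` carrier S))"
    by (fact quotient_kernel_isomorphic_image[OF zero_hom_ann_pair])
qed

section \<open>The 3-nilpotent ideal and its complement\<close>

definition two_sided_null :: "'a set"
  where "two_sided_null = {a \<in> carrier S. \<forall>s\<in>carrier S. \<forall>t\<in>carrier S. s \<cdot> a \<cdot> t = \<zero>}"

lemma ideal_two_sided_null: "ideal two_sided_null S"
proof -
  have "\<zero> \<in> two_sided_null"
    by (simp add: two_sided_null_def zero_closed zero_mult mult_zero)
  moreover have "s \<cdot> a \<in> two_sided_null" "a \<cdot> s \<in> two_sided_null"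
    if "a \<in> two_sided_null" "s \<in> carrier S" for a s
  proof -
    have a: "a \<in> carrier S" and null: "\<And>x y. \<lbrakk>x \<in> carrier S; y \<in> carrier S\<rbrakk> \<Longrightarrow> x \<cdot> a \<cdot> y = \<zero>"
      using that(1) by (auto simp: two_sided_null_def)
    have "x \<cdot> (s \<cdot> a) \<cdot> y = \<zero>" "x \<cdot> (a \<cdot> s) \<cdot> y = \<zero>"
      if "x \<in> carrier S" "y \<in> carrier S" for x y
      \<comment> \<open>The factor \<open>s\<close> is absorbed into the neighbouring outer factor:
        \<open>x \<cdot> s\<close> on the left, \<open>s \<cdot> y\<close> on the right.\<close>
      using null[of "x \<cdot> s" y] null[of x "s \<cdot> y"] that a \<open>s \<in> carrier S\<close>
      by (simp_all add: mult_closed mult_assoc)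
    then show "s \<cdot> a \<in> two_sided_null" "a \<cdot> s \<in> two_sided_null"
      using a \<open>s \<in> carrier S\<close> by (simp_all add: two_sided_null_def mult_closed)
  qed
  ultimately show ?thesis
    by (auto simp: ideal_def) (simp add: two_sided_null_def)
qed

text \<open>The defining condition of the ideal is applied to the middle factor.\<close>

lemma three_nilpotent_two_sided_null: "three_nilpotent (restrict_to S two_sided_null)"
  by (simp add: three_nilpotent_def two_sided_null_def)

lemma not_two_sided_null_mult:
  assumes "a \<in> carrier S - two_sided_null" "b \<in> carrier S - two_sided_null" "a \<cdot> b \<noteq> \<zero>"
  shows "a \<cdot> b \<in> carrier S - two_sided_null"
proof -
  have ab: "a \<in> carrier S" "b \<in> carrier S" using assms by auto
  obtain s where s: "s \<in> carrier S" "s \<cdot> a \<noteq> \<zero>"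
    using assms(1) by (auto simp: two_sided_null_def mult_mult_eq_zero_iff)
  obtain t where t: "t \<in> carrier S" "b \<cdot> t \<noteq> \<zero>"
    using assms(2) by (auto simp: two_sided_null_def mult_mult_eq_zero_iff)
  have "s \<cdot> (a \<cdot> b) \<noteq> \<zero>" "a \<cdot> b \<cdot> t \<noteq> \<zero>"
    using mult_mult_eq_zero_iff[OF s(1) ab] mult_mult_eq_zero_iff[OF ab t(1)]
      mult_assoc[OF s(1) ab] s t assms(3) by auto
  \<comment> \<open>Categoricity at zero is used once more, now with \<open>a \<cdot> b\<close> as
    the middle factor.\<close>
  then have "s \<cdot> (a \<cdot> b) \<cdot> t \<noteq> \<zero>"
    using mult_mult_eq_zero_iff[of s "a \<cdot> b" t] s t ab by (simp add: mult_closed)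
  then show ?thesis
    using s t ab by (auto simp: two_sided_null_def mult_closed)
qed

lemma splitting_two_sided_null:
  "splitting_ideal_extension S two_sided_null (carrier S - two_sided_null \<union> {\<zero>})"
  using ideal_two_sided_null not_two_sided_null_mult zero_closed zero_mult mult_zero
  unfolding splitting_ideal_extension_def subsemigroup_def by blast

text \<open>This allows the embedding result to be applied to \<open>T\<close> itself, with
  annihilators taken inside \<open>T\<close> instead of \<open>S\<close>.\<close>

lemma plain_K_semigroup_restrict_to:
  assumes "subsemigroup T S"
  shows "plain_K_semigroup (restrict_to S T)"
proof -
  have sub: "a \<in> carrier S" if "a \<in> T" for a
    using assms that by (auto simp: subsemigroup_def)
  have T: "\<zero> \<in> T" "\<And>a b. \<lbrakk>a \<in> T; b \<in> T\<rbrakk> \<Longrightarrow> a \<cdot> b \<in> T"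
    using assms by (auto simp: subsemigroup_def)
  show ?thesis
  proof (unfold_locales, unfold restrict_to_simps)
    show "f \<cdot> g = \<zero> \<or> g \<cdot> h = \<zero>"
      if "f \<in> T" "g \<in> T" "h \<in> T" "f \<cdot> g \<cdot> h = \<zero>" for f g h
      using that sub categorical_at_zero by blast
  qed (simp_all add: sub T mult_assoc zero_mult mult_zero)
qed

end

theorem theorem1:
  fixes S :: "'a semigroup0"
  assumes "K_semigroup S"
  shows "\<exists>A T. splitting_ideal_extension S A T \<and> three_nilpotent (restrict_to S A) \<and>
    (\<exists>\<rho>. greatest_zero_restricted_congruence (restrict_to S T) \<rho> \<and>
      (\<exists>(I :: 'a set set) (\<Lambda> :: 'a set set) W P.
         (\<forall>l\<in>\<Lambda>. \<forall>i\<in>I. W l i \<in> {0, 1}) \<and>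
         subsemigroup P (Rees I \<Lambda> W) \<and>
         isomorphic (quotient_semigroup (restrict_to S T) \<rho>) (restrict_to (Rees I \<Lambda> W) P)))"
proof -
  interpret plain_K_semigroup S
    using assms
    by (intro plain_K_semigroup.intro plain_semigroup_with_zero.intro K_semigroup.axioms(1))
  let ?T = "carrier S - two_sided_null \<union> {\<zero>\<^bsub>S\<^esub>}"
  have "subsemigroup ?T S"
    using splitting_two_sided_null by (simp add: splitting_ideal_extension_def)
  then have "plain_K_semigroup (restrict_to S ?T)"
    by (rule plain_K_semigroup_restrict_to)
  then show ?thesis
    by (intro exI[of _ two_sided_null] exI[of _ ?T] conjI splitting_two_sided_null
        three_nilpotent_two_sided_null plain_K_semigroup.quotient_embeds_in_Rees)
qed

end
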